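(* Let $m\ge 1$ be an integer. For any tree $T$ of order $m$, every maximally connected cograph $G\not\cong K_m$ with $\delta(G)\ge m-1$ contains a subtree $T'\cong T$ such that $G-V(T')$ is maximally connected.
   Context: Graphs are finite, simple and undirected. The order of a graph is its number of vertices; $\delta(G)$ is the minimum degree. Cographs are defined recursively: $K_1$ is a cograph; the disjoint union of cographs is a cograph; the join of cographs is a cograph, where the join $G_1+G_2$ of vertex-disjoint graphs is obtained from their disjoint union by adding all edges between $V(G_1)$ and $V(G_2)$. (Equivalently, cographs are the graphs with no induced path $P_4$ on four vertices.) The connectivity $\kappa(G)$ is the minimum number of vertices whose removal from $G$ results in a disconnected graph or a trivial graph (a graph of order 1); in particular $\kappa(K_1)=0$. $G$ is maximally connected if $\kappa(G)=\delta(G)$. For a proper subset $S\subsetneq V(G)$, $G-S$ is the graph obtained by deleting all vertices of $S$. A subtree of $G$ is a (not necessarily induced) subgraph that is a tree. *)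

theory Defs
  imports Graph_Theory.Kuratowski Graph_Theory.Digraph_Isomorphism
begin

text \<open>
  A finite simple undirected graph is a \<^const>\<open>pair_graph\<close>: a finite vertex set with a finite,
  symmetric, irreflexive adjacency relation; each undirected edge is a pair of opposite arcs.
\<close>

definition graph_union ::
    "'a pair_pre_digraph \<Rightarrow> 'a pair_pre_digraph \<Rightarrow> 'a pair_pre_digraph" where
  "graph_union G H = \<lparr> pverts = pverts G \<union> pverts H, parcs = parcs G \<union> parcs H \<rparr>"

definition graph_join ::
    "'a pair_pre_digraph \<Rightarrow> 'a pair_pre_digraph \<Rightarrow> 'a pair_pre_digraph" where
  "graph_join G H = \<lparr> pverts = pverts G \<union> pverts H,
     parcs = parcs G \<union> parcs H \<union> pverts G \<times> pverts H \<union> pverts H \<times> pverts G \<rparr>"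

inductive cograph :: "'a pair_pre_digraph \<Rightarrow> bool" where
  single: "cograph \<lparr> pverts = {v}, parcs = {} \<rparr>"
| union: "\<lbrakk>cograph G; cograph H; pverts G \<inter> pverts H = {}\<rbrakk> \<Longrightarrow> cograph (graph_union G H)"
| join: "\<lbrakk>cograph G; cograph H; pverts G \<inter> pverts H = {}\<rbrakk> \<Longrightarrow> cograph (graph_join G H)"

lemma cograph_pair_graph: "cograph G \<Longrightarrow> pair_graph G \<and> pverts G \<noteq> {}"
proof (induction rule: cograph.induct)
  case (single v)
  show ?case by (simp, unfold_locales, auto simp: symmetric_def sym_def)
next
  case (union G H)
  then interpret G: pair_graph G by simp
  interpret H: pair_graph H using union by simp
  show ?case using union G.no_loops H.no_loops
    by (intro conjI, unfold_locales)
      (auto simp: graph_union_def symmetric_def sym_def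
        intro: G.in_arcsD1 G.in_arcsD2 H.in_arcsD1 H.in_arcsD2 G.arcs_symmetric H.arcs_symmetric)
next
  case (join G H)
  then interpret G: pair_graph G by simp
  interpret H: pair_graph H using join by simp
  show ?case using join G.no_loops H.no_loops
    by (intro conjI, unfold_locales)
      (auto simp: graph_join_def symmetric_def sym_def
        intro: G.in_arcsD1 G.in_arcsD2 H.in_arcsD1 H.in_arcsD2 G.arcs_symmetric H.arcs_symmetric)
qed

text \<open>
  The library's \<^const>\<open>tree\<close> is unsuitable for undirected graphs: its notion of cycle includes the
  closed walk \<open>u, v, u\<close> along an edge and back. In a symmetric digraph without loops the cycles of
  length at least 3 are exactly the cycles of the undirected graph.
\<close>

definition undirected_tree :: "'a pair_pre_digraph \<Rightarrow> bool" where
  "undirected_tree T \<longleftrightarrow> pair_graph T \<and> connected (with_proj T) \<and>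
     \<not> (\<exists>p. pre_digraph.cycle (with_proj T) p \<and> 3 \<le> length p)"

text \<open>
  The remaining notions are meant for symmetric loop-free digraphs, where the out-degree of a vertex
  is its degree in the undirected graph. They are unspecified on the null graph.
\<close>

definition min_degree :: "('a, 'b) pre_digraph \<Rightarrow> nat" where
  "min_degree G = Min (out_degree G ` verts G)"

definition delete_verts :: "('a, 'b) pre_digraph \<Rightarrow> 'a set \<Rightarrow> ('a, 'b) pre_digraph" where
  "delete_verts G S = G \<restriction> (verts G - S)"

definition connectivity :: "('a, 'b) pre_digraph \<Rightarrow> nat" where
  "connectivity G = (LEAST k. \<exists>S. S \<subset> verts G \<and> card S = k \<and>
     (\<not> connected (delete_verts G S) \<or> card (verts (delete_verts G S)) = 1))"

definition maximally_connected :: "('a, 'b) pre_digraph \<Rightarrow> bool" where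
  "maximally_connected G \<longleftrightarrow> connectivity G = min_degree G"

end

theory Submission
  imports Defs Graph_Theory.Vertex_Walk "HOL-Library.Disjoint_Sets"
begin

text \<open>
  Call the vertex sets of the components of the complement of a cograph its parts: vertices of
  different parts are adjacent, and a part with more than one vertex induces a disconnected graph.
  Deleting everything outside a part bounds the connectivity by \<open>n\<close> minus the size of the part, so a
  maximally connected cograph has a largest part \<open>H\<close> containing a vertex \<open>v\<close> isolated in \<open>H\<close>, and
  \<open>n - card H\<close> is the minimum degree. Conversely, a graph stays maximally connected under deletion of
  a vertex set that avoids \<open>v\<close> and leaves no part with more vertices than are left of \<open>H\<close>.

  It remains to place the tree accordingly. Let \<open>A\<close>, \<open>B\<close> be its colour classes, with
  \<open>card A \<le> card B\<close>. Fill parts other than \<open>H\<close> with vertices of \<open>B\<close>; only the last part \<open>C\<close> used is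
  filled partially, by a set \<open>P\<close> with at most \<open>card P\<close> neighbours. Top up \<open>C\<close> with vertices of \<open>A\<close> that
  have no neighbour in \<open>P\<close>, put the rest of \<open>A\<close> into the unused parts, and what does not fit into
  \<open>H - {v}\<close>. If \<open>H\<close> is used at all, then only \<open>C\<close> can have vertices left among the other parts.
\<close>

section \<open>Forests\<close>

text \<open>For a symmetric loop-free \<open>E\<close> and finite \<open>X\<close> this
  characterises forests. In this form it is visibly inherited by subsets, as the inductions below
  need, and the placement uses acyclicity only through it.\<close>

definition one_degenerate :: "('a \<times> 'a) set \<Rightarrow> 'a set \<Rightarrow> bool" where
  "one_degenerate E X \<longleftrightarrow> (\<forall>Y\<subseteq>X. Y \<noteq> {} \<longrightarrow> (\<exists>x\<in>Y. card (E `` {x} \<inter> Y) \<le> 1))"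

lemma one_degenerate_subset: "one_degenerate E X \<Longrightarrow> Y \<subseteq> X \<Longrightarrow> one_degenerate E Y"
  unfolding one_degenerate_def by (meson order_trans)

text \<open>Delete a vertex with at most one neighbour, colour the rest by induction, and give the
  deleted vertex the colour opposite to that neighbour's.\<close>

lemma degenerate_bicolouring:
  assumes "finite X" "sym E"
    and "one_degenerate E X"
    and irrefl: "\<And>x. (x, x) \<notin> E"
  shows "\<exists>A\<subseteq>X. \<forall>x\<in>X. \<forall>y\<in>X. (x, y) \<in> E \<longrightarrow> (x \<in> A) \<noteq> (y \<in> A)"
  using assms(1,3)
proof (induction "card X" arbitrary: X)
  case 0
  then show ?case by auto
next
  case (Suc n)
  then obtain x where x: "x \<in> X" "card (E `` {x} \<inter> X) \<le> 1"
    unfolding one_degenerate_def by (metis card.empty nat.simps(3) order_refl)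
  have "\<exists>A\<subseteq>X - {x}. \<forall>y\<in>X - {x}. \<forall>z\<in>X - {x}. (y, z) \<in> E \<longrightarrow> (y \<in> A) \<noteq> (z \<in> A)"
    using Suc.hyps(2) Suc.prems x one_degenerate_subset[of E X "X - {x}"]
    by (intro Suc.hyps(1)) (auto simp: card_Diff_singleton)
  then obtain A where A: "A \<subseteq> X - {x}"
    "\<And>y z. y \<in> X - {x} \<Longrightarrow> z \<in> X - {x} \<Longrightarrow> (y, z) \<in> E \<Longrightarrow> (y \<in> A) \<noteq> (z \<in> A)"
    by blast
  have uniq: "y = z" if "(x, y) \<in> E" "(x, z) \<in> E" "y \<in> X" "z \<in> X" for y z
    using card_le_Suc0_iff_eq[of "E `` {x} \<inter> X"] x(2) that Suc.prems(1) by auto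
  define A' where "A' = (if E `` {x} \<inter> A = {} then insert x A else A)"
  have nb: "(x \<in> A') \<noteq> (y \<in> A')" if "y \<in> X" "(x, y) \<in> E" for y
    using that uniq A(1) irrefl unfolding A'_def by auto
  have "A' \<subseteq> X" using A(1) x by (auto simp: A'_def)
  moreover have "(y \<in> A') \<noteq> (z \<in> A')" if "y \<in> X" "z \<in> X" "(y, z) \<in> E" for y z
  proof (cases "y = x \<or> z = x")
    case True
    then show ?thesis using nb that \<open>sym E\<close> by (metis symD)
  next
    case False
    then show ?thesis using A(2)[of y z] that by (auto simp: A'_def)
  qed
  ultimately show ?case by blast
qed

text \<open>A nonempty forest has fewer edges than vertices, since deleting a vertex with at most
  one neighbour loses at most one edge. Counting arcs from \<open>B\<close> to \<open>A\<close>
  counts each edge between these sets once.\<close>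

lemma degenerate_edge_bound:
  assumes "finite X" "sym E"
    and "one_degenerate E X"
    and "A \<inter> B = {}" and "X \<noteq> {}"
  shows "card (E \<inter> (X \<inter> B) \<times> (X \<inter> A)) < card X"
  using assms(1,3,5)
proof (induction "card X" arbitrary: X)
  case 0
  then show ?case by auto
next
  case (Suc n)
  then obtain x where x: "x \<in> X" "card (E `` {x} \<inter> X) \<le> 1"
    unfolding one_degenerate_def by (metis order_refl)
  let ?e = "\<lambda>X. E \<inter> (X \<inter> B) \<times> (X \<inter> A)"
  \<comment> \<open>The counted arcs at \<open>x\<close> leave it if \<open>x\<close> is in
    \<open>B\<close> and enter it otherwise; by symmetry of \<open>E\<close> the neighbours of
    \<open>x\<close> index both kinds.\<close>
  let ?D = "if x \<in> B then (\<lambda>y. (x, y)) ` (E `` {x} \<inter> X) else (\<lambda>y. (y, x)) ` (E `` {x} \<inter> X)"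
  have fin: "finite (?e (X - {x}))" "finite ?D"
    using Suc.prems(1) by (auto intro: finite_subset[of _ "X \<times> X"])
  have "?e X \<subseteq> ?e (X - {x}) \<union> ?D"
  proof (intro subrelI)
    fix b a assume ba: "(b, a) \<in> ?e X"
    then have "(a, b) \<in> E" using \<open>sym E\<close> by (blast dest: symD)
    with ba show "(b, a) \<in> ?e (X - {x}) \<union> ?D"
      using assms(4) by (cases "b = x"; cases "a = x") (auto simp: image_iff)
  qed
  then have "card (?e X) \<le> card (?e (X - {x})) + card ?D"
    using fin by (meson card_Un_le card_mono finite_UnI le_trans)
  also have "card ?D \<le> 1"
    using x(2) Suc.prems(1) by (simp add: card_image inj_on_def)
  finally have le: "card (?e X) \<le> card (?e (X - {x})) + 1" by simp
  show ?case
  proof (cases "X = {x}")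
    case True
    then have "?e X = {}" using assms(4) by auto
    then show ?thesis using Suc.hyps(2) by simp
  next
    case False
    have "card (?e (X - {x})) < card (X - {x})"
      using Suc.hyps(2) Suc.prems x False one_degenerate_subset[of E X "X - {x}"]
      by (intro Suc.hyps(1)) (auto simp: card_Diff_singleton)
    then show ?thesis using le x Suc.prems(1) by (simp add: card_Diff_singleton)
  qed
qed

text \<open>
  The colour class \<open>B\<close> of a forest is peeled off one vertex at a time. As long as the rest of \<open>B\<close> is
  at least as large as the rest of \<open>A\<close>, counting edges gives a vertex of \<open>B\<close> with at most one
  neighbour left, and this neighbour is removed together with it.
\<close>

lemma degenerate_peeling:
  assumes fin: "finite A" "finite B" and "sym E" and "A \<inter> B = {}"
    and deg: "one_degenerate E (A \<union> B)"
    and "card A \<le> card B" and "p \<le> card B"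
  shows "\<exists>P\<subseteq>B. \<exists>Q\<subseteq>A. card P = p \<and> card Q = min p (card A) \<and> E \<inter> P \<times> (A - Q) = {}"
  using \<open>p \<le> card B\<close>
proof (induction p)
  case 0
  show ?case
    by (rule exI[of _ "{}"], rule conjI, simp, rule exI[of _ "{}"], simp)
next
  case (Suc p)
  then obtain P Q where PQ: "P \<subseteq> B" "Q \<subseteq> A" "card P = p" "card Q = min p (card A)"
    "E \<inter> P \<times> (A - Q) = {}"
    using Suc_leD by blast
  let ?A = "A - Q" and ?B = "B - P"
  have cA: "card ?A = card A - min p (card A)" and cB: "card ?B = card B - p"
    using PQ fin by (simp_all add: card_Diff_subset finite_subset)
  have le: "card ?A \<le> card ?B" and pos: "0 < card ?B"
    unfolding cA cB using assms(6) Suc.prems by linarith+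
  have fAB: "finite ?A" "finite ?B" using fin by auto
  have "\<exists>b\<in>?B. card (E `` {b} \<inter> ?A) \<le> 1"
  proof (rule ccontr)
    \<comment> \<open>Otherwise at least \<open>2 * card ?B\<close> edges join \<open>?B\<close> and
      \<open>?A\<close>, whereas a forest on these vertices has fewer than
      \<open>card ?A + card ?B \<le> 2 * card ?B\<close>.\<close>
    assume "\<not> ?thesis"
    then have two: "2 \<le> card (E `` {b} \<inter> ?A)" if "b \<in> ?B" for b
      using that by force
    have "E \<inter> ?B \<times> ?A = (SIGMA b:?B. E `` {b} \<inter> ?A)" by auto
    then have "card (E \<inter> ?B \<times> ?A) = (\<Sum>b\<in>?B. card (E `` {b} \<inter> ?A))"
      using fAB by (simp add: card_SigmaI)
    also have "\<dots> \<ge> (\<Sum>b\<in>?B. 2)"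
      using two by (intro sum_mono) auto
    finally have "2 * card ?B \<le> card (E \<inter> ?B \<times> ?A)" by simp
    also have "E \<inter> ?B \<times> ?A = E \<inter> ((?A \<union> ?B) \<inter> B) \<times> ((?A \<union> ?B) \<inter> A)"
      using assms(4) by auto
    also have "card \<dots> < card (?A \<union> ?B)"
      using fAB \<open>sym E\<close> \<open>A \<inter> B = {}\<close> pos one_degenerate_subset[OF deg, of "?A \<union> ?B"]
      by (intro degenerate_edge_bound) (auto simp: card_gt_0_iff)
    also have "\<dots> \<le> card ?A + card ?B" by (rule card_Un_le)
    finally show False using le by simp
  qed
  then obtain b where b: "b \<in> ?B" "card (E `` {b} \<inter> ?A) \<le> 1" by blast
  \<comment> \<open>If \<open>b\<close> has no neighbour left, \<open>Q'\<close> is padded by an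
    arbitrary vertex of \<open>?A\<close>, if there is one. This keeps the size of \<open>Q\<close>
    exact, as the computation of \<open>card ?A\<close> requires.\<close>
  have "\<exists>Q'. E `` {b} \<inter> ?A \<subseteq> Q' \<and> Q' \<subseteq> ?A \<and> card Q' = min 1 (card ?A)"
  proof (cases "E `` {b} \<inter> ?A = {}")
    case True
    obtain Q' where "Q' \<subseteq> ?A" "card Q' = min 1 (card ?A)"
      by (meson min.cobounded2 obtain_subset_with_card_n)
    with True show ?thesis by blast
  next
    case False
    then have "0 < card (E `` {b} \<inter> ?A)" "0 < card ?A"
      using fAB by (auto simp: card_gt_0_iff)
    then have "card (E `` {b} \<inter> ?A) = min 1 (card ?A)" using b(2) by linarith
    then show ?thesis by blast
  qed
  then obtain Q' where Q': "E `` {b} \<inter> ?A \<subseteq> Q'" "Q' \<subseteq> ?A" "card Q' = min 1 (card ?A)"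
    by blast
  have "card (insert b P) = Suc p"
    using b PQ fin by (simp add: finite_subset)
  moreover have "card (Q \<union> Q') = min (Suc p) (card A)"
  proof -
    have "card (Q \<union> Q') = card Q + card Q'"
      using PQ(2) Q'(2) fin finite_subset by (intro card_Un_disjoint) blast+
    also have "\<dots> = min p (card A) + min 1 (card A - min p (card A))"
      using PQ(4) Q'(3) cA by simp
    also have "\<dots> = min (Suc p) (card A)" by linarith
    finally show ?thesis .
  qed
  moreover have "E \<inter> insert b P \<times> (A - (Q \<union> Q')) = {}"
    using PQ Q' by blast
  moreover have "insert b P \<subseteq> B" "Q \<union> Q' \<subseteq> A"
    using PQ(1,2) Q'(2) b(1) by blast+
  ultimately show ?case by blast
qed

section \<open>Placing a forest in a complete multipartite graph\<close>

text \<open>When the classes are added one by one, \<open>C\<close> is the one with which the total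
  size first reaches \<open>b\<close>.\<close>

lemma union_of_classes_threshold:
  fixes b :: nat
  assumes "finite K" and "0 < b" and "b \<le> card (\<Union>K)"
  shows "\<exists>W\<subseteq>K. \<exists>C\<in>K - W. card (\<Union>W) < b \<and> b \<le> card (\<Union>W \<union> C)"
  using assms(1,3)
proof (induction K)
  case empty
  then show ?case using assms(2) by simp
next
  case (insert C K)
  show ?case
  proof (cases "b \<le> card (\<Union>K)")
    case True
    then obtain W D where "W \<subseteq> K" "D \<in> K - W" "card (\<Union>W) < b" "b \<le> card (\<Union>W \<union> D)"
      using insert.IH by blast
    then show ?thesis by blast
  next
    case False
    moreover have "b \<le> card (\<Union>K \<union> C)"
      using insert.prems by (simp add: Un_commute)
    ultimately show ?thesis
      using insert.hyps by (intro exI[of _ K] conjI bexI[of _ C]) auto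
  qed
qed

lemma bij_betw_If_disjoint:
  assumes "bij_betw f X Y" "bij_betw g X' Y'" "X \<inter> X' = {}" "Y \<inter> Y' = {}"
  shows "bij_betw (\<lambda>x. if x \<in> X then f x else g x) (X \<union> X') (Y \<union> Y')"
proof (rule bij_betw_combine)
  show "bij_betw (\<lambda>x. if x \<in> X then f x else g x) X Y"
    using assms(1) by (simp cong: bij_betw_cong)
  have "bij_betw (\<lambda>x. if x \<in> X then f x else g x) X' Y' \<longleftrightarrow> bij_betw g X' Y'"
    using assms(3) by (intro bij_betw_cong) auto
  then show "bij_betw (\<lambda>x. if x \<in> X then f x else g x) X' Y'"
    using assms(2) by simp
qed (rule assms(4))

text \<open>\<open>K\<close> stands for the parts other than \<open>H\<close>, and \<open>v\<close>
  is to be spared. The bound \<open>abK\<close> renders the degree condition; \<open>H1\<close>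
  renders the exclusion of the complete graph, because with \<open>H = {v}\<close> the whole forest
  has to fit outside \<open>H\<close>. The last two conclusions send edges to edges and keep the
  rest of \<open>H\<close> a largest part.\<close>

lemma multipartite_placement:
  assumes fin: "finite A" "finite B" and "sym E" and AB: "A \<inter> B = {}"
    and bip: "E \<subseteq> A \<times> B \<union> B \<times> A"
    and deg: "one_degenerate E (A \<union> B)"
    and le: "card A \<le> card B" and pos: "0 < card B"
    and finK: "finite K" "\<And>C. C \<in> K \<Longrightarrow> finite C" and "disjoint K"
    and finH: "finite H" and HK: "H \<inter> \<Union>K = {}" and v: "v \<in> H"
    and small: "\<And>C. C \<in> K \<Longrightarrow> card C \<le> card H"
    and bK: "card B \<le> card (\<Union>K)" and abK: "card A + card B \<le> card (\<Union>K) + 1"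
    and H1: "card H = 1 \<Longrightarrow> card A + card B \<le> card (\<Union>K)"
  shows "\<exists>f. inj_on f (A \<union> B) \<and> f ` (A \<union> B) \<subseteq> (H \<union> \<Union>K) - {v} \<and>
    (\<forall>C\<in>insert H K. \<forall>x y. (x, y) \<in> E \<longrightarrow> f x \<in> C \<longrightarrow> f y \<notin> C) \<and>
    (\<forall>C\<in>K. card (C - f ` (A \<union> B)) \<le> card (H - f ` (A \<union> B)))"
proof -
  obtain \<W> C where WC: "\<W> \<subseteq> K" "C \<in> K - \<W>" "card (\<Union>\<W>) < card B" "card B \<le> card (\<Union>\<W> \<union> C)"
    using union_of_classes_threshold[OF finK(1) pos bK] by blast
  define W where "W = \<Union>\<W>"
  define D where "D = \<Union>K - (W \<union> C)"
  have finU: "finite (\<Union>K)" using finK by auto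
  have WK: "W \<subseteq> \<Union>K" "C \<subseteq> \<Union>K" "D \<subseteq> \<Union>K"
    using WC by (auto simp: W_def D_def)
  have finWCD: "finite W" "finite C" "finite D"
    using WK finU by (auto intro: rev_finite_subset)
  have same: "C1 = C2" if "C1 \<in> K" "C2 \<in> K" "z \<in> C1" "z \<in> C2" for C1 C2 z
    using \<open>disjoint K\<close> that unfolding disjoint_def by blast
  have inW: "C' \<in> \<W>" if "C' \<in> K" "z \<in> C'" "z \<in> W" for C' z
    using that same WC(1) unfolding W_def by blast
  have WCdisj: "W \<inter> C = {}" using inW WC(2) by blast
  have cWC: "card (W \<union> C) = card W + card C"
    using finWCD WCdisj by (simp add: card_Un_disjoint)
  have cK: "card (\<Union>K) = card W + card C + card D"
    using card_Diff_subset[of "W \<union> C" "\<Union>K"] card_mono[OF finU, of "W \<union> C"] WK finWCD cWC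
    by (simp add: D_def)
  \<comment> \<open>Once \<open>W\<close> is full, \<open>p\<close> vertices of \<open>B\<close>
    remain for \<open>C\<close>. Peeling chooses them as a set \<open>P\<close> whose neighbours all
    lie in a set \<open>Q\<close> of at most \<open>p\<close> vertices.\<close>
  define p where "p = card B - card W"
  have p: "0 < p" "p \<le> card C" "p \<le> card B" "card C \<le> card H"
    using WC small cWC by (auto simp: p_def W_def)
  obtain P Q where PQ: "P \<subseteq> B" "Q \<subseteq> A" "card P = p" "card Q = min p (card A)"
    "E \<inter> P \<times> (A - Q) = {}"
    using degenerate_peeling[OF fin \<open>sym E\<close> AB deg le p(3)] by blast
  have cAQ: "card (A - Q) = card A - min p (card A)"
    using PQ fin by (simp add: card_Diff_subset finite_subset)
  \<comment> \<open>Vertices of \<open>A - Q\<close> have no neighbour in \<open>P\<close> and may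
    share \<open>C\<close> with it; as many are taken as exist and fit.\<close>
  define a1 where "a1 = min (card C - p) (card (A - Q))"
  obtain A1 where A1: "A1 \<subseteq> A - Q" "card A1 = a1"
    using obtain_subset_with_card_n[of a1 "A - Q"] unfolding a1_def by (metis min.cobounded2)
  define A2 where "A2 = A - A1"
  have cA2: "card A2 = card A - a1"
    using A1 fin finite_subset[of A1 A] unfolding A2_def by (subst card_Diff_subset) auto
  have a1le: "a1 \<le> card C - p" "a1 \<le> card A"
    using cAQ by (auto simp: a1_def)
  have Hpos: "0 < card H" using v finH card_gt_0_iff by blast
  \<comment> \<open>\<open>card A2 - card D\<close> is the overflow into \<open>H\<close>, zero by
    truncation if \<open>A2\<close> fits into \<open>D\<close>. It must spare \<open>v\<close> and
    must leave in \<open>H\<close> at least as many vertices as are left in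
    \<open>C\<close>.\<close>
  have arith: "card A2 - card D \<le> card H - 1"
    "(card A2 - card D) + (card C - p - a1) \<le> card H"
  proof -
    have pB: "card B = p + card W" using WC(3) by (simp add: p_def W_def)
    \<comment> \<open>Either \<open>C\<close> is filled up, and then \<open>abK\<close> and
      \<open>H1\<close> allow an overflow of at most one, and none if \<open>card H = 1\<close>; or
      \<open>A1\<close> exhausts \<open>A - Q\<close>, and then \<open>A2\<close> is
      \<open>Q\<close>, with at most \<open>p < card C \<le> card H\<close> vertices.\<close>
    consider "a1 = card C - p" | "a1 = card A - min p (card A)" "a1 < card C - p"
      using cAQ unfolding a1_def by linarith
    then have "card A2 - card D \<le> card H - 1 \<and> (card A2 - card D) + (card C - p - a1) \<le> card H"
    proof cases
      case 1
      then have "card A2 - card D \<le> 1" "card H = 1 \<Longrightarrow> card A2 - card D = 0"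
        using abK H1 cK cA2 pB p by linarith+
      then show ?thesis using 1 Hpos by linarith
    next
      case 2
      then have "card A2 \<le> p" using cA2 by linarith
      then show ?thesis using 2 p by linarith
    qed
    then show "card A2 - card D \<le> card H - 1"
      "(card A2 - card D) + (card C - p - a1) \<le> card H" by blast+
  qed
  \<comment> \<open>\<open>D\<close> is filled before \<open>H\<close> is touched, so
    \<open>D\<close> is used up whenever \<open>H\<close> is used.\<close>
  have "\<exists>X2\<subseteq>D \<union> (H - {v}). card X2 = card A2 \<and> (X2 \<subseteq> D \<or> D \<subseteq> X2)"
  proof (cases "card A2 \<le> card D")
    case True
    then obtain X2 where "X2 \<subseteq> D" "card X2 = card A2"
      using obtain_subset_with_card_n by metis
    then show ?thesis by blast
  next
    case False
    have "card A2 - card D \<le> card (H - {v})" using arith(1) v finH by simp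
    then obtain Y where Y: "Y \<subseteq> H - {v}" "card Y = card A2 - card D"
      using obtain_subset_with_card_n by metis
    have "D \<inter> Y = {}" "finite Y" using Y HK WK finH finite_subset[of Y H] by auto
    then have "card (D \<union> Y) = card A2"
      using Y False finWCD by (simp add: card_Un_disjoint)
    then show ?thesis using Y by (intro exI[of _ "D \<union> Y"]) auto
  qed
  then obtain X2 where X2: "X2 \<subseteq> D \<union> (H - {v})" "card X2 = card A2" "X2 \<subseteq> D \<or> D \<subseteq> X2"
    by blast
  have finX2: "finite X2" using X2(1) finWCD finH by (meson finite_Diff finite_UnI finite_subset)
  have "p + a1 \<le> card C" using p(2) a1le(1) by linarith
  then obtain C1 where C1: "C1 \<subseteq> C" "card C1 = p + a1"
    using obtain_subset_with_card_n by metis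
  have finsub: "finite P" "finite A1" "finite A2" "finite C1"
    using PQ A1 C1 fin finWCD by (auto simp: A2_def intro: rev_finite_subset)
  have "card (B - P) = card W"
    using PQ fin WC(3) by (simp add: card_Diff_subset finite_subset p_def W_def)
  then obtain g1 where g1: "bij_betw g1 (B - P) W"
    using finite_same_card_bij fin finWCD by (metis finite_Diff)
  have PA1: "P \<inter> A1 = {}" using PQ A1 AB by blast
  have "card (P \<union> A1) = card C1"
    using PA1 finsub PQ(3) A1(2) C1(2) by (simp add: card_Un_disjoint)
  then obtain g2 where g2: "bij_betw g2 (P \<union> A1) C1"
    using finite_same_card_bij[of "P \<union> A1" C1] finsub by blast
  obtain g3 where g3: "bij_betw g3 A2 X2"
    using finite_same_card_bij[of A2 X2] finsub finX2 X2 by auto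
  define h where "h = (\<lambda>x. if x \<in> P \<union> A1 then g2 x else g3 x)"
  define f where "f = (\<lambda>x. if x \<in> B - P then g1 x else h x)"
  have "D \<inter> (W \<union> C) = {}" by (auto simp: D_def)
  moreover have "H \<inter> (W \<union> C \<union> D) = {}" using HK WK by blast
  ultimately have X2WC: "X2 \<inter> (W \<union> C) = {}" and HWC: "H \<inter> (W \<union> C) = {}" and HD: "H \<inter> D = {}"
    using X2(1) by blast+
  have C1X2: "C1 \<inter> X2 = {}" using C1(1) X2WC by blast
  have WX: "W \<inter> (C1 \<union> X2) = {}" using WCdisj C1(1) X2WC by blast
  have h: "bij_betw h (P \<union> A1 \<union> A2) (C1 \<union> X2)"
    unfolding h_def using g2 g3 C1X2 AB PQ by (intro bij_betw_If_disjoint) (auto simp: A2_def)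
  have "bij_betw f ((B - P) \<union> (P \<union> A1 \<union> A2)) (W \<union> (C1 \<union> X2))"
    unfolding f_def using g1 h WX AB A1 by (intro bij_betw_If_disjoint) (auto simp: A2_def)
  moreover have "(B - P) \<union> (P \<union> A1 \<union> A2) = A \<union> B"
    using PQ A1 by (auto simp: A2_def)
  ultimately have f: "inj_on f (A \<union> B)" "f ` (A \<union> B) = W \<union> (C1 \<union> X2)"
    by (auto simp: bij_betw_def)
  have fB: "f x \<in> W" if "x \<in> B - P" for x
    using that g1 by (auto simp: f_def bij_betw_def)
  have fP: "f x \<in> C" if "x \<in> P \<union> A1" for x
    using that g2 C1 A1 AB by (auto simp: f_def h_def bij_betw_def)
  have fA2: "f x \<in> X2" if "x \<in> A2" for x
    using that g3 AB PQ by (auto simp: f_def h_def bij_betw_def A2_def)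
  \<comment> \<open>If \<open>x\<close> is in \<open>P\<close>, then \<open>y\<close> is in
    \<open>Q\<close>, hence in \<open>A2\<close> and placed outside \<open>C\<close>. Otherwise
    \<open>x\<close> is placed in \<open>W\<close>, which receives no vertex of
    \<open>A\<close>.\<close>
  have apart: False if C': "C' \<in> insert H K" and xy: "(x, y) \<in> E" "x \<in> B" "y \<in> A"
    and "f x \<in> C'" "f y \<in> C'" for C' x y
  proof (cases "x \<in> P")
    case True
    then have "f x \<in> C" using fP by blast
    then have "C' = C" using C' \<open>f x \<in> C'\<close> same WC(2) HWC by blast
    have "y \<notin> A1" using True xy PQ(5) A1 by blast
    then have "f y \<in> X2" using xy fA2 by (simp add: A2_def)
    then show False using \<open>C' = C\<close> \<open>f y \<in> C'\<close> X2WC by blast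
  next
    case False
    then have "f x \<in> W" using xy fB by blast
    then have "C' \<in> \<W>" using C' \<open>f x \<in> C'\<close> inW HWC by blast
    then have "f y \<in> W" using \<open>f y \<in> C'\<close> by (auto simp: W_def)
    moreover have "f y \<in> C \<union> X2" using xy fP fA2 by (auto simp: A2_def)
    ultimately show False using WCdisj X2WC by blast
  qed
  have "f y \<notin> C'" if "C' \<in> insert H K" "(x, y) \<in> E" "f x \<in> C'" for C' x y
  proof -
    have "(y, x) \<in> E" using \<open>sym E\<close> that(2) by (rule symD)
    then show ?thesis using apart[OF that(1)] that bip by blast
  qed
  moreover have "card (C' - f ` (A \<union> B)) \<le> card (H - f ` (A \<union> B))" if C': "C' \<in> K" for C'
  \<comment> \<open>If \<open>H\<close> is untouched, its maximality suffices. Otherwise every part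
    in \<open>K\<close> except \<open>C\<close> is used up, and for \<open>C\<close> the second
    inequality of \<open>arith\<close> applies.\<close>
  proof (cases "X2 \<subseteq> D")
    case True
    then have "H - f ` (A \<union> B) = H" using f(2) HWC HD C1(1) by blast
    then show ?thesis
      using small[OF C'] card_mono[OF finK(2)[OF C'], of "C' - f ` (A \<union> B)"] by simp
  next
    case False
    then have DX: "D \<subseteq> X2" using X2 by blast
    have "C' \<in> \<W> \<or> C' = C \<or> C' \<subseteq> D"
      using C' same inW WC(2) unfolding D_def by blast
    then consider "C' \<in> \<W>" | "C' = C" | "C' \<subseteq> D" by blast
    then show ?thesis
    proof cases
      case 2
      have "H - f ` (A \<union> B) = H - (X2 - D)" using f(2) HWC HD C1(1) by blast
      moreover have "X2 - D \<subseteq> H" using X2 by blast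
      moreover have "card (X2 - D) = card A2 - card D"
        using DX X2 finWCD by (simp add: card_Diff_subset)
      ultimately have "card (H - f ` (A \<union> B)) = card H - (card A2 - card D)"
        using finX2 by (simp add: card_Diff_subset)
      moreover have "card (C - f ` (A \<union> B)) \<le> card (C - C1)"
        using f finWCD by (intro card_mono) auto
      moreover have "card (C - C1) = card C - p - a1"
        using C1 finsub by (simp add: card_Diff_subset)
      ultimately show ?thesis using arith(2) unfolding 2 by linarith
    next
      case 1
      then have "C' - f ` (A \<union> B) = {}" using f(2) by (auto simp: W_def)
      then show ?thesis by (simp only: card.empty le0)
    next
      case 3
      then have "C' - f ` (A \<union> B) = {}" using f(2) DX by blast
      then show ?thesis by (simp only: card.empty le0)
    qed
  qed
  moreover have "f ` (A \<union> B) \<subseteq> (H \<union> \<Union>K) - {v}"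
    using f(2) X2(1) C1(1) WK HWC HD v by blast
  ultimately show ?thesis using f(1) by blast
qed

section \<open>Trees\<close>

text \<open>Paths are built below as vertex lists, whereas cycles are lists of arcs; this translates
  between the two.\<close>

lemma awalk_vwalk_arcs:
  assumes "xs \<noteq> []"
  shows "pcas (hd xs) (vwalk_arcs xs) (last xs)"
    and "pawalk_verts (hd xs) (vwalk_arcs xs) = xs"
  using assms by (induction xs rule: vwalk_arcs.induct) auto

text \<open>In a longest path through vertices with two neighbours in \<open>Y\<close>, the end vertex has a neighbour
  on the path other than its successor, which closes a cycle.\<close>

lemma undirected_tree_one_degenerate:
  assumes "undirected_tree T"
  shows "one_degenerate (parcs T) (pverts T)"
proof (rule ccontr)
  interpret T: pair_graph T using assms by (simp add: undirected_tree_def)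
  assume "\<not> ?thesis"
  then obtain Y where Y: "Y \<subseteq> pverts T" "Y \<noteq> {}"
    and two: "\<And>x. x \<in> Y \<Longrightarrow> \<not> card (parcs T `` {x} \<inter> Y) \<le> 1"
    unfolding one_degenerate_def by metis
  have finY: "finite Y" using Y T.pair_finite_verts finite_subset by blast
  define path where "path xs \<longleftrightarrow> xs \<noteq> [] \<and> distinct xs \<and> set xs \<subseteq> Y \<and> set (vwalk_arcs xs) \<subseteq> parcs T"
    for xs
  obtain y where "y \<in> Y" using Y by blast
  then have "path [y]" by (simp add: path_def)
  moreover have "length xs \<le> card Y" if "path xs" for xs
    using that card_mono[OF finY, of "set xs"] by (simp add: path_def distinct_card)
  ultimately obtain xs where xs: "path xs" and max: "\<And>ys. path ys \<Longrightarrow> length ys \<le> length xs"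
    using ex_has_greatest_nat[of path "[y]" length "Suc (card Y)"] less_Suc_eq_le by metis
  obtain x r where xr: "xs = x # r" using xs by (cases xs) (auto simp: path_def)
  let ?N = "parcs T `` {x} \<inter> Y"
  have "x \<in> Y" using xs xr by (auto simp: path_def)
  \<comment> \<open>A neighbour of \<open>x\<close> in \<open>Y\<close> off the path would prolong
    the longest path \<open>xs\<close> at its front.\<close>
  have nbr: "z \<in> set r" if "z \<in> ?N" for z
  proof (rule ccontr)
    assume "z \<notin> set r"
    moreover have "z \<noteq> x" using that T.no_loops' by blast
    moreover have "(z, x) \<in> parcs T" using that T.arcs_symmetric by blast
    ultimately have "path (z # xs)" using xs xr that by (auto simp: path_def)
    then show False using max by fastforce
  qed
  have "?N \<noteq> {}" using two[OF \<open>x \<in> Y\<close>] by force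
  then obtain y r' where r: "r = y # r'" using nbr by (cases r) auto
  \<comment> \<open>The second neighbour \<open>z\<close> lies beyond \<open>y\<close> on the path,
    so the cycle closed by the arc from \<open>z\<close> to \<open>x\<close> has length at least 3
    and is not just an edge walked back and forth.\<close>
  have "\<not> ?N \<subseteq> {y}" using two[OF \<open>x \<in> Y\<close>] card_mono[of "{y}" ?N] by auto
  then obtain z where z: "z \<in> ?N" "z \<noteq> y" by blast
  then have "z \<in> set r'" using nbr r by auto
  then obtain us ws where r': "r' = us @ z # ws" by (meson split_list)
  define c where "c = x # y # us @ [z]"
  have c: "xs = c @ ws" "last c = z" "c \<noteq> []" by (auto simp: c_def xr r r')
  let ?p = "vwalk_arcs (c @ [x])"
  have "set (vwalk_arcs c) \<subseteq> parcs T"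
    using set_vwalk_arcs_append1[of c ws] xs c by (auto simp: path_def)
  moreover have "(z, x) \<in> parcs T" using z T.arcs_symmetric by blast
  ultimately have "set ?p \<subseteq> parcs T" using c by (auto simp: set_vwalk_arcs_snoc)
  moreover have "pcas x ?p x" "pawalk_verts x ?p = c @ [x]"
    using awalk_vwalk_arcs[of "c @ [x]"] by (auto simp: c_def)
  moreover have "x \<in> pverts T" using \<open>x \<in> Y\<close> Y by blast
  moreover have "distinct (tl (c @ [x]))" using xs c by (auto simp: path_def c_def)
  moreover have len: "length ?p = length c"
    using vwalk_length_simp[of "c @ [x]"] by (simp add: vwalk_length_def del: vwalk_length_simp)
  ultimately have "T.cycle ?p"
    unfolding T.cycle_def T.awalk_def by (metis c(3) length_0_conv)
  moreover have "3 \<le> length ?p" unfolding len by (simp add: c_def)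
  ultimately show False using assms unfolding undirected_tree_def by blast
qed

section \<open>Isomorphic copies of trees\<close>

lemma cycle_app_iso:
  assumes "wf_digraph G" "pre_digraph.cycle G p" "pre_digraph.digraph_isomorphism G hom"
  shows "pre_digraph.cycle (app_iso hom G) (map (iso_arcs hom) p)"
proof -
  interpret wf_digraph G by fact
  obtain u where u: "awalk u p u" "distinct (tl (awalk_verts u p))" "p \<noteq> []"
    using assms(2) unfolding cycle_def by blast
  have "inj_on (iso_verts hom) (set (tl (awalk_verts u p)))"
    using assms(3) u(1) awalkE list.set_sel(2) awalk_verts_non_Nil
    unfolding digraph_isomorphism_def by (metis (no_types, lifting) inj_on_subset subset_iff)
  then have "distinct (tl (map (iso_verts hom) (awalk_verts u p)))"
    using u(2) by (simp add: distinct_map flip: map_tl)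
  then show ?thesis
    unfolding pre_digraph.cycle_def
    using u awalk_app_isoI[OF u(1) assms(3)] awalk_verts_app_iso_eq[OF assms(3) u(1)] by auto
qed

definition pair_image :: "('a \<Rightarrow> 'b) \<Rightarrow> 'a pair_pre_digraph \<Rightarrow> 'b pair_pre_digraph" where
  "pair_image f T = \<lparr>pverts = f ` pverts T, parcs = map_prod f f ` parcs T\<rparr>"

text \<open>Presents the image as an instance of \<open>app_iso\<close>, so that connectedness and
  cycles can be transported along the isomorphism.\<close>

lemma pair_image_iso:
  assumes "pair_graph T" "inj_on f (pverts T)"
  defines "hom \<equiv> \<lparr>iso_verts = f, iso_arcs = map_prod f f, iso_head = snd, iso_tail = fst\<rparr>"
  shows "pre_digraph.digraph_isomorphism (with_proj T) hom"
    and "with_proj (pair_image f T) = app_iso hom (with_proj T)"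
proof -
  interpret T: pair_graph T by fact
  have "inj_on (map_prod f f) (parcs T)"
    using map_prod_inj_on[OF assms(2,2)] by (rule inj_on_subset) (use T.wellformed' in auto)
  then show "pre_digraph.digraph_isomorphism (with_proj T) hom"
    using assms(2) T.wf_digraph by (auto simp: pre_digraph.digraph_isomorphism_def hom_def)
  show "with_proj (pair_image f T) = app_iso hom (with_proj T)"
    by (simp add: pair_image_def app_iso_def hom_def with_proj_def)
qed

lemma pair_graph_pair_image:
  assumes "pair_graph T" "inj_on f (pverts T)"
  shows "pair_graph (pair_image f T)"
proof -
  interpret T: pair_graph T by fact
  show ?thesis
  proof
    show "symmetric (with_proj (pair_image f T))"
      using T.arcs_symmetric by (auto simp: symmetric_def pair_image_def intro!: symI)
    fix e assume "e \<in> parcs (pair_image f T)"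
    then obtain x y where xy: "(x, y) \<in> parcs T" "e = (f x, f y)" by (auto simp: pair_image_def)
    then have "x \<in> pverts T" "y \<in> pverts T" "x \<noteq> y"
      using T.wellformed' T.no_loops' by blast+
    then show "fst e \<in> pverts (pair_image f T)" "snd e \<in> pverts (pair_image f T)" "fst e \<noteq> snd e"
      using xy assms(2) by (auto simp: pair_image_def dest: inj_onD)
  qed (simp_all add: pair_image_def T.pair_finite_verts T.pair_finite_arcs)
qed

lemma undirected_tree_pair_image:
  assumes "undirected_tree T" "inj_on f (pverts T)"
  shows "undirected_tree (pair_image f T)" and "digraph_iso (with_proj (pair_image f T)) (with_proj T)"
proof -
  interpret T: pair_graph T using assms(1) by (simp add: undirected_tree_def)
  obtain hom where hom: "pre_digraph.digraph_isomorphism (with_proj T) hom"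
    "with_proj (pair_image f T) = app_iso hom (with_proj T)"
    using pair_image_iso[OF T.pair_graph assms(2)] by blast
  then show "digraph_iso (with_proj (pair_image f T)) (with_proj T)"
    using digraph_iso_swap[OF T.wf_digraph] unfolding digraph_iso_def by blast
  have "connected (with_proj (pair_image f T))"
    using T.connectedI_app_iso[OF _ hom(1)] assms(1) hom(2) by (simp add: undirected_tree_def)
  moreover have False if p: "pre_digraph.cycle (with_proj (pair_image f T)) p" "3 \<le> length p" for p
  proof -
    \<comment> \<open>A cycle of the image is pulled back along the inverse isomorphism, which
      preserves its length.\<close>
    have "pre_digraph.digraph_isomorphism (app_iso hom (with_proj T)) (pre_digraph.inv_iso (with_proj T) hom)"
      using T.digraph_isomorphism_invI[OF hom(1)] .
    then have "pre_digraph.cycle (with_proj T) (map (iso_arcs (pre_digraph.inv_iso (with_proj T) hom)) p)"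
      using cycle_app_iso[of "app_iso hom (with_proj T)" p "pre_digraph.inv_iso (with_proj T) hom"]
        p(1) hom T.app_iso_inv[OF hom(1)] T.wf_digraphI_app_iso[OF hom(1)] by simp
    then show False using p(2) assms(1) unfolding undirected_tree_def by (metis length_map)
  qed
  ultimately show "undirected_tree (pair_image f T)"
    using pair_graph_pair_image[OF T.pair_graph assms(2)] by (auto simp: undirected_tree_def)
qed

section \<open>Connectivity and cographs\<close>

definition pair_induce :: "'a pair_pre_digraph \<Rightarrow> 'a set \<Rightarrow> 'a pair_pre_digraph" where
  "pair_induce G X = \<lparr>pverts = X, parcs = parcs G \<inter> X \<times> X\<rparr>"

lemma pair_induce_simps [simp]:
  "pverts (pair_induce G X) = X" "parcs (pair_induce G X) = parcs G \<inter> X \<times> X"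
  by (simp_all add: pair_induce_def)

lemma delete_verts_with_proj:
  "delete_verts (with_proj G) S = with_proj (pair_induce G (pverts G - S))"
  by (auto simp: delete_verts_def induce_subgraph_def with_proj_def pair_induce_def)

lemma pair_graph_induce:
  assumes "pair_graph G" "X \<subseteq> pverts G"
  shows "pair_graph (pair_induce G X)"
proof -
  interpret G: pair_graph G by fact
  show ?thesis
  proof
    show "symmetric (with_proj (pair_induce G X))"
      using G.arcs_symmetric by (auto simp: symmetric_def intro!: symI)
  qed (use assms(2) G.pair_finite_verts G.pair_finite_arcs G.no_loops in \<open>auto intro: finite_subset\<close>)
qed

lemma pair_graph_connected_iff:
  assumes "pair_graph G"
  shows "connected (with_proj G) \<longleftrightarrow>
    pverts G \<noteq> {} \<and> (\<forall>x\<in>pverts G. \<forall>y\<in>pverts G. (x, y) \<in> (parcs G)\<^sup>*)"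
proof -
  interpret G: pair_graph G by fact
  have "connected (with_proj G) \<longleftrightarrow>
    pverts G \<noteq> {} \<and> (\<forall>x\<in>pverts G. \<forall>y\<in>pverts G. x \<rightarrow>\<^sup>*\<^bsub>with_proj G\<^esub> y)"
    using G.reachable_mk_symmetric_eq[OF G.sym_arcs]
    by (simp add: connected_def strongly_connected_def)
  then show ?thesis using G.reachable_conv' by simp
qed

lemma connected_if_diameter_le_2:
  assumes "pair_graph G" "pverts G \<noteq> {}"
    and "\<And>x y. x \<in> pverts G \<Longrightarrow> y \<in> pverts G \<Longrightarrow> (x, y) \<in> parcs G \<or> (\<exists>z. (x, z) \<in> parcs G \<and> (z, y) \<in> parcs G)"
  shows "connected (with_proj G)"
  unfolding pair_graph_connected_iff[OF assms(1)]
  using assms(2,3) by (meson converse_rtrancl_into_rtrancl r_into_rtrancl)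

text \<open>A disconnection of the subgraph induced on \<open>C\<close>, phrased so that it depends
  only on the arcs inside \<open>C\<close>. For symmetric arcs one direction is enough.\<close>

definition splits :: "'a pair_pre_digraph \<Rightarrow> 'a set \<Rightarrow> bool" where
  "splits G C \<longleftrightarrow> (\<exists>X Y. C = X \<union> Y \<and> X \<inter> Y = {} \<and> X \<noteq> {} \<and> Y \<noteq> {} \<and> parcs G \<inter> X \<times> Y = {})"

lemma splitsI:
  "C = X \<union> Y \<Longrightarrow> X \<inter> Y = {} \<Longrightarrow> X \<noteq> {} \<Longrightarrow> Y \<noteq> {} \<Longrightarrow> parcs G \<inter> X \<times> Y = {} \<Longrightarrow> splits G C"
  unfolding splits_def by blast

lemma splits_mono: "splits G C \<Longrightarrow> parcs H \<inter> C \<times> C \<subseteq> parcs G \<Longrightarrow> splits H C"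
  unfolding splits_def by fast

lemma not_connected_if_splits:
  assumes "pair_graph G" "splits G (pverts G)"
  shows "\<not> connected (with_proj G)"
proof
  interpret G: pair_graph G by fact
  obtain X Y where XY: "pverts G = X \<union> Y" "X \<inter> Y = {}" "X \<noteq> {}" "Y \<noteq> {}" "parcs G \<inter> X \<times> Y = {}"
    using assms(2) unfolding splits_def by blast
  assume con: "connected (with_proj G)"
  obtain x y where "x \<in> X" "y \<in> Y" using XY by blast
  then have "(x, y) \<in> (parcs G)\<^sup>*"
    using con XY(1) by (simp add: pair_graph_connected_iff[OF assms(1)])
  then have "y \<in> X"
    by (induction rule: rtrancl_induct) (use \<open>x \<in> X\<close> XY G.in_arcsD2 in blast)+
  then show False using \<open>y \<in> Y\<close> XY(2) by blast
qed

section \<open>Connectivity and minimum degree\<close>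

definition separating :: "'a pair_pre_digraph \<Rightarrow> 'a set \<Rightarrow> bool" where
  "separating G S \<longleftrightarrow> S \<subset> pverts G \<and>
    (\<not> connected (with_proj (pair_induce G (pverts G - S))) \<or> card (pverts G - S) = 1)"

lemma connectivity_with_proj:
  "connectivity (with_proj G) = (LEAST k. \<exists>S. separating G S \<and> card S = k)"
  unfolding connectivity_def separating_def delete_verts_with_proj
  by (rule arg_cong[where f = Least]) auto

lemma connectivity_le:
  assumes "separating G S"
  shows "connectivity (with_proj G) \<le> card S"
  unfolding connectivity_with_proj using assms by (intro Least_le) blast

lemma connectivity_ge:
  assumes "pverts G \<noteq> {}" and "\<And>S. separating G S \<Longrightarrow> k \<le> card S"
  shows "k \<le> connectivity (with_proj G)"
proof -
  obtain v where "v \<in> pverts G" using assms(1) by blast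
  \<comment> \<open>Deleting all vertices but one is separating, so the minimum defining the
    connectivity is attained.\<close>
  then have "pverts G - (pverts G - {v}) = {v}" by blast
  then have "separating G (pverts G - {v})"
    using \<open>v \<in> pverts G\<close> by (auto simp: separating_def)
  then have "\<exists>S. separating G S \<and> card S = connectivity (with_proj G)"
    unfolding connectivity_with_proj
    by (intro LeastI_ex[where P = "\<lambda>k. \<exists>S. separating G S \<and> card S = k"]) blast
  then show ?thesis using assms(2) by metis
qed

lemma out_degree_with_proj: "out_degree (with_proj G) x = card (parcs G `` {x})"
proof -
  have "out_arcs (with_proj G) x = Pair x ` (parcs G `` {x})" by auto
  then show ?thesis by (simp add: out_degree_def card_image inj_on_def)
qed

lemma min_degree_with_proj:
  assumes "finite (pverts G)" "pverts G \<noteq> {}"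
  shows "\<exists>u\<in>pverts G. min_degree (with_proj G) = card (parcs G `` {u})"
    and "x \<in> pverts G \<Longrightarrow> min_degree (with_proj G) \<le> card (parcs G `` {x})"
proof -
  have "min_degree (with_proj G) \<in> (\<lambda>x. card (parcs G `` {x})) ` pverts G"
    unfolding min_degree_def out_degree_with_proj with_proj_simps using assms by (intro Min_in) auto
  then show "\<exists>u\<in>pverts G. min_degree (with_proj G) = card (parcs G `` {u})" by blast
  show "min_degree (with_proj G) \<le> card (parcs G `` {x})" if "x \<in> pverts G"
    unfolding min_degree_def out_degree_with_proj with_proj_simps
    using assms that by (intro Min_le) auto
qed

text \<open>Deleting the neighbours of a vertex of minimum degree leaves that vertex isolated or
  alone.\<close>

lemma connectivity_le_min_degree:
  assumes "pair_graph G" "pverts G \<noteq> {}"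
  shows "connectivity (with_proj G) \<le> min_degree (with_proj G)"
proof -
  interpret G: pair_graph G by fact
  obtain u where u: "u \<in> pverts G" "min_degree (with_proj G) = card (parcs G `` {u})"
    using min_degree_with_proj(1)[OF G.pair_finite_verts assms(2)] by blast
  let ?S = "parcs G `` {u}" and ?R = "pverts G - parcs G `` {u}"
  have uR: "u \<in> ?R" using u G.no_loops' by blast
  have "separating G ?S"
  proof (cases "?R = {u}")
    case True
    then show ?thesis using uR G.in_arcsD2 by (auto simp: separating_def)
  next
    case False
    have "\<not> connected (with_proj (pair_induce G ?R))"
      using uR False pair_graph_induce[OF assms(1), of ?R]
      by (intro not_connected_if_splits splitsI[where X = "{u}" and Y = "?R - {u}"]) auto
    then show ?thesis using uR G.in_arcsD2 by (auto simp: separating_def)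
  qed
  then show ?thesis using connectivity_le u(2) by metis
qed

section \<open>Multipartite structure of cographs\<close>

text \<open>The function \<open>c\<close> labels the parts of a spanning complete multipartite subgraph.\<close>

lemma maximally_connected_if_multipartite:
  assumes "pair_graph G" and v: "v \<in> pverts G"
    and adj: "\<And>x y. x \<in> pverts G \<Longrightarrow> y \<in> pverts G \<Longrightarrow> c x \<noteq> c y \<Longrightarrow> (x, y) \<in> parcs G"
    and iso: "\<And>y. (v, y) \<in> parcs G \<Longrightarrow> c y \<noteq> c v"
    and small: "\<And>x. x \<in> pverts G \<Longrightarrow> card {y \<in> pverts G. c y = c x} \<le> card {y \<in> pverts G. c y = c v}"
  shows "maximally_connected (with_proj G)"
proof -
  interpret G: pair_graph G by fact
  let ?V = "pverts G" and ?H = "{y \<in> pverts G. c y = c v}"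
  note fin = G.pair_finite_verts
  have ne: "?V \<noteq> {}" using v by blast
  have Hpos: "0 < card ?H" using v fin by (auto simp: card_gt_0_iff)
  have "parcs G `` {v} \<subseteq> ?V - ?H" using iso G.in_arcsD2 by blast
  then have "card (parcs G `` {v}) \<le> card ?V - card ?H"
    using fin card_mono[of "?V - ?H" "parcs G `` {v}"] by (simp add: card_Diff_subset)
  then have "min_degree (with_proj G) \<le> card ?V - card ?H"
    using min_degree_with_proj(2)[OF fin ne v] by linarith
  also have "card ?V - card ?H \<le> connectivity (with_proj G)"
  proof (rule connectivity_ge[OF ne], rule ccontr)
    fix S assume S: "separating G S" "\<not> card ?V - card ?H \<le> card S"
    let ?R = "?V - S"
    have "S \<subseteq> ?V" using S by (auto simp: separating_def)
    then have "card ?R = card ?V - card S"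
      using fin by (intro card_Diff_subset) (auto intro: finite_subset)
    then have big: "card ?H < card ?R" using S by linarith
    \<comment> \<open>More vertices remain than any part contains, so each remaining vertex sees
      another part; two remaining vertices of the same part therefore have a common
      neighbour.\<close>
    have other: "\<exists>z\<in>?R. c z \<noteq> c x" if "x \<in> ?R" for x
    proof (rule ccontr)
      assume "\<not> ?thesis"
      then have "?R \<subseteq> {y \<in> ?V. c y = c x}" by blast
      then have "card ?R \<le> card {y \<in> ?V. c y = c x}" using fin by (intro card_mono) auto
      then show False using big small[of x] that by simp
    qed
    have "connected (with_proj (pair_induce G ?R))"
    proof (rule connected_if_diameter_le_2)
      show "pair_graph (pair_induce G ?R)" using pair_graph_induce[OF assms(1)] by blast
      show "pverts (pair_induce G ?R) \<noteq> {}"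
        using big by (metis card.empty not_less0 pair_induce_simps(1))
      fix x y assume xy: "x \<in> pverts (pair_induce G ?R)" "y \<in> pverts (pair_induce G ?R)"
      then obtain z where "z \<in> ?R" "c z \<noteq> c x" using other by auto
      then show "(x, y) \<in> parcs (pair_induce G ?R) \<or>
        (\<exists>z. (x, z) \<in> parcs (pair_induce G ?R) \<and> (z, y) \<in> parcs (pair_induce G ?R))"
        using xy adj[of x y] adj[of x z] adj[of z y] by (cases "c x = c y") auto
    qed
    moreover have "card ?R \<noteq> 1" using big Hpos by linarith
    ultimately show False using S(1) by (simp add: separating_def)
  qed
  finally show ?thesis
    using connectivity_le_min_degree[OF assms(1) ne] by (simp add: maximally_connected_def)
qed

text \<open>The parts are the vertex sets of the connected components of the complement.\<close>

lemma cograph_parts: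
  assumes "cograph G"
  shows "\<exists>c :: 'a \<Rightarrow> 'a. c ` pverts G \<subseteq> pverts G \<and>
    (\<forall>x\<in>pverts G. \<forall>y\<in>pverts G. c x \<noteq> c y \<longrightarrow> (x, y) \<in> parcs G) \<and>
    (\<forall>x\<in>pverts G. {y \<in> pverts G. c y = c x} = {x} \<or> splits G {y \<in> pverts G. c y = c x})"
    (is "\<exists>c. ?P G c")
  using assms
proof (induction rule: cograph.induct)
  case (single v)
  show ?case by (intro exI[of _ "\<lambda>_. v"]) auto
next
  case (union G H)
  interpret G: pair_graph G using cograph_pair_graph[OF union.hyps(1)] by blast
  interpret H: pair_graph H using cograph_pair_graph[OF union.hyps(2)] by blast
  obtain a where a: "a \<in> pverts G" using cograph_pair_graph[OF union.hyps(1)] by blast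
  have "pverts H \<noteq> {}" using cograph_pair_graph[OF union.hyps(2)] by blast
  moreover have "(parcs G \<union> parcs H) \<inter> pverts G \<times> pverts H = {}"
    using union.hyps(3) G.in_arcsD2 H.in_arcsD1 by blast
  \<comment> \<open>A disjoint union is disconnected, so all of it can form a single part, with
    constant label \<open>a\<close>.\<close>
  ultimately have "splits (graph_union G H) (pverts (graph_union G H))"
    using a union.hyps(3) by (intro splitsI[of _ "pverts G" "pverts H"]) (auto simp: graph_union_def)
  moreover have "a \<in> pverts (graph_union G H)" using a by (simp add: graph_union_def)
  ultimately show ?case by (intro exI[of _ "\<lambda>_. a"]) (simp add: image_subset_iff)
next
  case (join G H)
  interpret G: pair_graph G using cograph_pair_graph[OF join.hyps(1)] by blast
  interpret H: pair_graph H using cograph_pair_graph[OF join.hyps(2)] by blast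
  obtain c where c: "c ` pverts G \<subseteq> pverts G"
    "\<And>x y. x \<in> pverts G \<Longrightarrow> y \<in> pverts G \<Longrightarrow> c x \<noteq> c y \<Longrightarrow> (x, y) \<in> parcs G"
    "\<And>x. x \<in> pverts G \<Longrightarrow> {y \<in> pverts G. c y = c x} = {x} \<or> splits G {y \<in> pverts G. c y = c x}"
    using join.IH(1) by blast
  obtain d where d: "d ` pverts H \<subseteq> pverts H"
    "\<And>x y. x \<in> pverts H \<Longrightarrow> y \<in> pverts H \<Longrightarrow> d x \<noteq> d y \<Longrightarrow> (x, y) \<in> parcs H"
    "\<And>x. x \<in> pverts H \<Longrightarrow> {y \<in> pverts H. d y = d x} = {x} \<or> splits H {y \<in> pverts H. d y = d x}"
    using join.IH(2) by blast
  \<comment> \<open>Labels from \<open>c\<close> lie in \<open>G\<close> and labels from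
    \<open>d\<close> in \<open>H\<close>, so no part of \<open>G\<close> merges with a part of
    \<open>H\<close>. This is why labels are required to be vertices of the graph.\<close>
  define e where "e = (\<lambda>x. if x \<in> pverts G then c x else d x)"
  let ?J = "graph_join G H"
  have J: "pverts ?J = pverts G \<union> pverts H"
    "parcs ?J = parcs G \<union> parcs H \<union> pverts G \<times> pverts H \<union> pverts H \<times> pverts G"
    by (simp_all add: graph_join_def)
  note disj = join.hyps(3)
  have eG: "e x = c x" "c x \<in> pverts G" if "x \<in> pverts G" for x
    using that c(1) by (auto simp: e_def)
  have eH: "e x = d x" "d x \<in> pverts H" if "x \<in> pverts H" for x
    using that d(1) disj by (auto simp: e_def)
  have clG: "{y \<in> pverts ?J. e y = e x} = {y \<in> pverts G. c y = c x}" if "x \<in> pverts G" for x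
    using eG eH that disj unfolding J by (metis (no_types, lifting) Un_iff disjoint_iff)
  have clH: "{y \<in> pverts ?J. e y = e x} = {y \<in> pverts H. d y = d x}" if "x \<in> pverts H" for x
    using eG eH that disj unfolding J by (metis (no_types, lifting) Un_iff disjoint_iff)
  show ?case
  proof (intro exI[of _ e] conjI ballI impI)
    show "e ` pverts ?J \<subseteq> pverts ?J" using eG eH unfolding J by force
    show "(x, y) \<in> parcs ?J" if xy: "x \<in> pverts ?J" "y \<in> pverts ?J" "e x \<noteq> e y" for x y
    proof -
      have "x \<in> pverts G \<and> y \<in> pverts G \<or> x \<in> pverts H \<and> y \<in> pverts H \<or>
        x \<in> pverts G \<and> y \<in> pverts H \<or> x \<in> pverts H \<and> y \<in> pverts G"
        using xy(1,2) unfolding J by blast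
      then show ?thesis
        using xy(3) c(2)[of x y] d(2)[of x y] eG(1) eH(1) unfolding J(2) by force
    qed
    fix x assume "x \<in> pverts ?J"
    then consider "x \<in> pverts G" | "x \<in> pverts H" unfolding J by blast
    then show "{y \<in> pverts ?J. e y = e x} = {x} \<or> splits ?J {y \<in> pverts ?J. e y = e x}"
    proof cases
      case 1
      have "parcs ?J \<inter> {y \<in> pverts G. c y = c x} \<times> {y \<in> pverts G. c y = c x} \<subseteq> parcs G"
        using disj H.in_arcsD1 unfolding J by blast
      then show ?thesis unfolding clG[OF 1] using c(3)[OF 1] splits_mono by blast
    next
      case 2
      have "parcs ?J \<inter> {y \<in> pverts H. d y = d x} \<times> {y \<in> pverts H. d y = d x} \<subseteq> parcs H"
        using disj G.in_arcsD1 unfolding J by blast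
      then show ?thesis unfolding clH[OF 2] using d(3)[OF 2] splits_mono by blast
    qed
  qed
qed

text \<open>Deleting all but one part bounds the connectivity, here equal to the minimum degree, by
  the number of vertices outside that part. A vertex \<open>v\<close> of minimum degree is adjacent
  to everything outside its own part, so for this part equality holds: \<open>v\<close> has no
  neighbour in it, and no other part is larger.\<close>

lemma maximally_connected_cograph_parts:
  assumes "cograph G" and mc: "maximally_connected (with_proj G)"
  obtains c :: "'a \<Rightarrow> 'a" and v where "v \<in> pverts G"
    and "\<And>x y. x \<in> pverts G \<Longrightarrow> y \<in> pverts G \<Longrightarrow> c x \<noteq> c y \<Longrightarrow> (x, y) \<in> parcs G"
    and "\<And>y. (v, y) \<in> parcs G \<Longrightarrow> c y \<noteq> c v"
    and "\<And>x. x \<in> pverts G \<Longrightarrow> card {y \<in> pverts G. c y = c x} \<le> card {y \<in> pverts G. c y = c v}"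
    and "min_degree (with_proj G) = card (pverts G - {y \<in> pverts G. c y = c v})"
proof -
  have pg: "pair_graph G" and ne: "pverts G \<noteq> {}" using cograph_pair_graph[OF assms(1)] by blast+
  interpret G: pair_graph G by fact
  let ?V = "pverts G"
  note fin = G.pair_finite_verts
  obtain c :: "'a \<Rightarrow> 'a" where adj: "\<And>x y. x \<in> ?V \<Longrightarrow> y \<in> ?V \<Longrightarrow> c x \<noteq> c y \<Longrightarrow> (x, y) \<in> parcs G"
    and split: "\<And>x. x \<in> ?V \<Longrightarrow> {y \<in> ?V. c y = c x} = {x} \<or> splits G {y \<in> ?V. c y = c x}"
    using cograph_parts[OF assms(1)] by blast
  have con: "connectivity (with_proj G) \<le> card (?V - {y \<in> ?V. c y = c x})" if x: "x \<in> ?V" for x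
  proof (rule connectivity_le)
    let ?C = "{y \<in> ?V. c y = c x}"
    have R: "?V - (?V - ?C) = ?C" by blast
    have "\<not> connected (with_proj (pair_induce G ?C)) \<or> card ?C = 1"
      using split[OF x]
    proof
      assume "splits G ?C"
      then have "splits (pair_induce G ?C) ?C" by (rule splits_mono) simp
      then show ?thesis
        using not_connected_if_splits[of "pair_induce G ?C"] pair_graph_induce[OF pg, of ?C] by simp
    qed simp
    moreover have "?V - ?C \<subset> ?V" using x by blast
    ultimately show "separating G (?V - ?C)" by (simp only: separating_def R simp_thms)
  qed
  obtain v where v: "v \<in> ?V" "min_degree (with_proj G) = card (parcs G `` {v})"
    using min_degree_with_proj(1)[OF fin ne] by blast
  let ?H = "{y \<in> ?V. c y = c v}"
  have diff: "card (?V - {y \<in> ?V. c y = c x}) + card {y \<in> ?V. c y = c x} = card ?V" for x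
    using fin card_mono[OF fin, of "{y \<in> ?V. c y = c x}"] by (simp add: card_Diff_subset)
  have sub: "?V - ?H \<subseteq> parcs G `` {v}"
  proof
    fix y assume "y \<in> ?V - ?H"
    then show "y \<in> parcs G `` {v}" using adj[OF v(1), of y] by auto
  qed
  have finN: "finite (parcs G `` {v})" using G.pair_finite_arcs by (rule finite_Image)
  have dle: "min_degree (with_proj G) \<le> card (?V - {y \<in> ?V. c y = c x})" if "x \<in> ?V" for x
    using con[OF that] mc by (simp add: maximally_connected_def)
  have eq: "?V - ?H = parcs G `` {v}"
    using card_seteq[OF finN sub] dle[OF v(1)] v(2) by simp
  have dH: "min_degree (with_proj G) = card (?V - ?H)" using eq v(2) by simp
  show thesis
  proof (rule that[of v c])
    show "card {y \<in> ?V. c y = c x} \<le> card ?H" if "x \<in> ?V" for x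
      using dH dle[OF that] diff[of x] diff[of v] by linarith
    show "c y \<noteq> c v" if "(v, y) \<in> parcs G" for y
      using that eq by blast
  qed (use v adj dH in blast)+
qed

section \<open>Trees in maximally connected cographs\<close>

lemma undirected_tree_bicolouring:
  assumes "undirected_tree T"
  obtains A B where "pverts T = A \<union> B" "A \<inter> B = {}" "parcs T \<subseteq> A \<times> B \<union> B \<times> A" "card A \<le> card B"
proof -
  interpret T: pair_graph T using assms by (simp add: undirected_tree_def)
  have "sym (parcs T)" using T.arcs_symmetric by (auto intro: symI)
  then obtain A where A: "A \<subseteq> pverts T"
    "\<And>x y. x \<in> pverts T \<Longrightarrow> y \<in> pverts T \<Longrightarrow> (x, y) \<in> parcs T \<Longrightarrow> (x \<in> A) \<noteq> (y \<in> A)"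
    using degenerate_bicolouring[OF T.pair_finite_verts _ undirected_tree_one_degenerate[OF assms]]
      T.no_loops' by metis
  let ?B = "pverts T - A"
  have "parcs T \<subseteq> A \<times> ?B \<union> ?B \<times> A"
  proof (intro subrelI)
    fix x y assume xy: "(x, y) \<in> parcs T"
    then show "(x, y) \<in> A \<times> ?B \<union> ?B \<times> A"
      using A(2)[OF _ _ xy] T.in_arcsD1[OF xy] T.in_arcsD2[OF xy] by blast
  qed
  moreover have "pverts T = A \<union> ?B" "A \<inter> ?B = {}" using A(1) by blast+
  ultimately show thesis
    using that[of A ?B] that[of ?B A] by (metis Int_commute Un_commute nle_le)
qed

lemma undirected_tree_no_arcs:
  assumes "undirected_tree T" "parcs T = {}"
  shows "card (pverts T) = 1"
proof -
  have "pverts T \<noteq> {} \<and> (\<forall>x\<in>pverts T. \<forall>y\<in>pverts T. (x, y) \<in> (parcs T)\<^sup>*)"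
    using assms(1) pair_graph_connected_iff unfolding undirected_tree_def by blast
  then have "pverts T \<noteq> {}" "\<forall>x\<in>pverts T. \<forall>y\<in>pverts T. x = y"
    unfolding assms(2) by simp_all
  then obtain x where "pverts T = {x}" by blast
  then show ?thesis by simp
qed

theorem theorem8:
  fixes m :: nat and T :: "'b pair_pre_digraph" and G :: "'a pair_pre_digraph"
  assumes "m \<ge> 1"
    and "undirected_tree T" and "card (pverts T) = m"
    and "cograph G" and "maximally_connected (with_proj G)"
    and "\<not> complete_digraph m (with_proj G)"
    and "min_degree (with_proj G) \<ge> m - 1"
  shows "\<exists>T' :: 'a pair_pre_digraph.
           subgraph (with_proj T') (with_proj G) \<and> undirected_tree T' \<and>
           digraph_iso (with_proj T') (with_proj T) \<and>
           pverts T' \<subset> pverts G \<and>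
           maximally_connected (delete_verts (with_proj G) (pverts T'))"
proof -
  have pg: "pair_graph G" using cograph_pair_graph[OF assms(4)] by blast
  interpret G: pair_graph G by fact
  interpret T: pair_graph T using assms(2) by (simp add: undirected_tree_def)
  let ?V = "pverts G"
  note fin = G.pair_finite_verts
  obtain c :: "'a \<Rightarrow> 'a" and v where v: "v \<in> ?V"
    and adj: "\<And>x y. x \<in> ?V \<Longrightarrow> y \<in> ?V \<Longrightarrow> c x \<noteq> c y \<Longrightarrow> (x, y) \<in> parcs G"
    and iso: "\<And>y. (v, y) \<in> parcs G \<Longrightarrow> c y \<noteq> c v"
    and small: "\<And>x. x \<in> ?V \<Longrightarrow> card {y \<in> ?V. c y = c x} \<le> card {y \<in> ?V. c y = c v}"
    and deg: "min_degree (with_proj G) = card (?V - {y \<in> ?V. c y = c v})"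
    by (rule maximally_connected_cograph_parts[OF assms(4,5)]) (rule that; assumption)
  define part where "part x = {y \<in> ?V. c y = c x}" for x
  define H where "H = part v"
  define K where "K = part ` ?V - {H}"
  have disj: "part x = part y" if "z \<in> part x" "z \<in> part y" for x y z
    using that by (auto simp: part_def)
  have HK: "H \<inter> \<Union>K = {}" using disj unfolding K_def H_def by blast
  have "?V \<subseteq> H \<union> \<Union>K" by (auto simp: K_def part_def)
  moreover have "H \<union> \<Union>K \<subseteq> ?V" by (auto simp: H_def K_def part_def)
  ultimately have V: "?V = H \<union> \<Union>K" by blast
  have UK: "\<Union>K = ?V - H" using V HK by blast
  have m: "m \<le> card (\<Union>K) + 1" using assms(7) deg unfolding UK H_def part_def by linarith
  have vH: "v \<in> H" using v by (simp add: H_def part_def)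
  have finH: "finite H" using fin V by (metis finite_Un)
  \<comment> \<open>If the largest part is a singleton, all parts are, and \<open>G\<close> is
    complete. Without the claimed bound its order would be exactly \<open>m\<close>, the excluded
    case.\<close>
  have H1: "m \<le> card (\<Union>K)" if "card H = 1"
  proof (rule ccontr)
    assume "\<not> ?thesis"
    moreover have "card ?V = card H + card (\<Union>K)"
      unfolding UK using fin V by (metis Un_upper1 card_Diff_subset card_mono finH le_add_diff_inverse)
    ultimately have "card ?V = m" using m that by linarith
    moreover have "parcs G = {(x, y). (x, y) \<in> ?V \<times> ?V \<and> x \<noteq> y}"
    proof -
      have "(x, y) \<in> parcs G" if xy: "x \<in> ?V" "y \<in> ?V" "x \<noteq> y" for x y
      proof (rule adj[OF xy(1,2)])
        show "c x \<noteq> c y"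
        proof
          assume "c x = c y"
          then have "{x, y} \<subseteq> {z \<in> ?V. c z = c y}" using xy by blast
          then have "card {x, y} \<le> card {z \<in> ?V. c z = c y}" using fin by (intro card_mono) auto
          then show False
            using small[OF xy(2)] xy(3) \<open>card H = 1\<close> by (simp add: H_def part_def)
        qed
      qed
      moreover have "x \<in> ?V \<and> y \<in> ?V \<and> x \<noteq> y" if "(x, y) \<in> parcs G" for x y
        using G.in_arcsD1[OF that] G.in_arcsD2[OF that] G.no_loops'[OF that] by blast
      ultimately show ?thesis by blast
    qed
    ultimately have "complete_digraph m (with_proj G)"
      unfolding complete_digraph_pair_def by (intro conjI fin)
    then show False using assms(6) by blast
  qed
  have "\<exists>f. inj_on f (pverts T) \<and> f ` pverts T \<subseteq> (H \<union> \<Union>K) - {v} \<and>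
    (\<forall>C\<in>insert H K. \<forall>x y. (x, y) \<in> parcs T \<longrightarrow> f x \<in> C \<longrightarrow> f y \<notin> C) \<and>
    (\<forall>C\<in>K. card (C - f ` pverts T) \<le> card (H - f ` pverts T))"
  proof (cases "card (\<Union>K) = 0")
    \<comment> \<open>With a single part the placement lemma does not apply, for \<open>B\<close> is
      nonempty. But then \<open>m = 1\<close>, and any vertex of \<open>H\<close> other than
      \<open>v\<close> serves; \<open>H1\<close> rules out \<open>H = {v}\<close>.\<close>
    case True
    then have "\<Union>K = {}" using fin V by (metis card_0_eq finite_Un)
    have "m = 1" using m True assms(1) by linarith
    then obtain t where t: "pverts T = {t}" using assms(3) card_1_singletonE by metis
    have "card H \<noteq> 1" using H1 True assms(1) by linarith
    then have "H \<noteq> {v}" by force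
    then obtain w where "w \<in> H" "w \<noteq> v" using vH by blast
    moreover have "(x, y) \<notin> parcs T" for x y
      using T.in_arcsD1[of x y] T.in_arcsD2[of x y] T.no_loops'[of x y] t by auto
    moreover have "card (C - X) \<le> n" if "C \<in> K" for C X and n :: nat
      using that \<open>\<Union>K = {}\<close> by auto
    ultimately show ?thesis using t by (intro exI[of _ "\<lambda>_. w"]) auto
  next
    case False
    obtain A B where AB: "pverts T = A \<union> B" "A \<inter> B = {}" "parcs T \<subseteq> A \<times> B \<union> B \<times> A" "card A \<le> card B"
      using undirected_tree_bicolouring[OF assms(2)] by blast
    have finAB: "finite A" "finite B" using T.pair_finite_verts AB(1) by auto
    have mAB: "m = card A + card B"
      using assms(3) AB(1,2) finAB by (simp add: card_Un_disjoint)
    \<comment> \<open>For nonempty \<open>A\<close> this follows from the bound on \<open>m\<close>.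
      If \<open>A\<close> is empty, the tree has no arcs, hence just one vertex.\<close>
    have "card B \<le> card (\<Union>K)"
    proof (cases "A = {}")
      case True
      then have "m = 1" using undirected_tree_no_arcs[OF assms(2)] assms(3) AB(3) by auto
      then show ?thesis using False mAB by linarith
    next
      case A: False
      then have "0 < card A" using finAB by (simp add: card_gt_0_iff)
      then show ?thesis using m mAB by linarith
    qed
    moreover have "sym (parcs T)" using T.arcs_symmetric by (auto intro: symI)
    moreover have "one_degenerate (parcs T) (A \<union> B)"
      using undirected_tree_one_degenerate[OF assms(2)] AB(1) by simp
    moreover have "0 < card B" using mAB AB(4) assms(1) by linarith
    moreover have "finite K" using fin by (simp add: K_def)
    moreover have "disjoint K"
    proof (rule disjointI)
      fix C D assume "C \<in> K" "D \<in> K" "C \<noteq> D"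
      then show "C \<inter> D = {}" using disj unfolding K_def by blast
    qed
    moreover have "finite C" "card C \<le> card H" if "C \<in> K" for C
      using that fin small by (auto simp: K_def H_def part_def)
    ultimately show ?thesis
      unfolding AB(1) using finAB AB(2-4) finH HK vH m H1 unfolding mAB
      by (intro multipartite_placement)
  qed
  then obtain f where f: "inj_on f (pverts T)" "f ` pverts T \<subseteq> ?V - {v}"
    and fc: "\<And>C x y. C \<in> insert H K \<Longrightarrow> (x, y) \<in> parcs T \<Longrightarrow> f x \<in> C \<Longrightarrow> f y \<notin> C"
    and fK: "\<And>C. C \<in> K \<Longrightarrow> card (C - f ` pverts T) \<le> card (H - f ` pverts T)"
    unfolding V by blast
  have pK: "part x \<in> insert H K" if "x \<in> ?V" for x using that by (simp add: K_def)
  have arc: "(f x, f y) \<in> parcs G" if xy: "(x, y) \<in> parcs T" for x y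
  proof -
    have fxy: "f x \<in> ?V" "f y \<in> ?V" using f(2) T.wellformed' xy by blast+
    have "f x \<in> part (f x)" using fxy by (simp add: part_def)
    then have "f y \<notin> part (f x)" using fc[OF pK[OF fxy(1)] xy] by blast
    then have "c (f x) \<noteq> c (f y)" using fxy by (auto simp: part_def)
    then show ?thesis using adj fxy by blast
  qed
  let ?T = "pair_image f T" and ?S = "f ` pverts T"
  note tree = undirected_tree_pair_image[OF assms(2) f(1)]
  have "wf_digraph (with_proj ?T)"
    using pair_graph_pair_image[OF T.pair_graph f(1)] pair_graph.pair_graphD_graph
    by (metis digraph.axioms(1) fin_digraph.axioms(1) graph_def)
  then have "subgraph (with_proj ?T) (with_proj G)"
    using arc f(2) G.wf_digraph by (auto simp: subgraph_def pair_image_def)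
  moreover have "maximally_connected (with_proj (pair_induce G (?V - ?S)))"
  \<comment> \<open>The labelling and \<open>v\<close> survive the deletion; \<open>fK\<close> gives
    the comparison of part sizes.\<close>
  proof (rule maximally_connected_if_multipartite[where v = v and c = c])
    show "pair_graph (pair_induce G (?V - ?S))" using pair_graph_induce[OF pg] by blast
    show "v \<in> pverts (pair_induce G (?V - ?S))" using v f(2) by auto
    show "(x, y) \<in> parcs (pair_induce G (?V - ?S))"
      if "x \<in> pverts (pair_induce G (?V - ?S))" "y \<in> pverts (pair_induce G (?V - ?S))" "c x \<noteq> c y" for x y
      using that adj by simp
    show "c y \<noteq> c v" if "(v, y) \<in> parcs (pair_induce G (?V - ?S))" for y
      using that iso by simp
    fix x assume "x \<in> pverts (pair_induce G (?V - ?S))"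
    then have "card (part x - ?S) \<le> card (H - ?S)" using pK[of x] fK[of "part x"] by auto
    moreover have "{y \<in> pverts (pair_induce G (?V - ?S)). c y = c z} = part z - ?S" for z
      by (auto simp: part_def)
    ultimately show "card {y \<in> pverts (pair_induce G (?V - ?S)). c y = c x}
      \<le> card {y \<in> pverts (pair_induce G (?V - ?S)). c y = c v}"
      unfolding H_def by simp
  qed
  moreover have "pverts ?T = ?S" by (simp add: pair_image_def)
  moreover have "?S \<subset> ?V" using f(2) v by blast
  ultimately show ?thesis
    using tree by (intro exI[of _ ?T]) (simp add: delete_verts_with_proj)
qed

end
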